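(* Let $q$ be an odd prime power. The following equalities hold in $\mathbb{F}_q$. (1) $\prod\{\,a \in \mathbb{F}_q : a \text{ and } 4-a \text{ are nonsquares} \,\} = 2$. (2) $\prod\{\,a \in \mathbb{F}_q : -a \text{ and } 4+a \text{ are nonsquares} \,\} = \left(\frac{2}{q}\right) 2$. (3) $\prod\{\,a \in \mathbb{F}_q^\times : 1-a \text{ and } a+3 \text{ are nonsquares} \,\}$ equals $2$ if $q \equiv \pm 1 \pmod{12}$, and equals $-1$ otherwise. (4) Suppose that $s,t\in\mathbb{F}_q^\times$ and $s^2 + t^2 = 4$. Then $$\prod\{\,a \in \mathbb{F}_q : s^2-a \text{ and } t^2+a \text{ are nonsquares} \,\} = \left(\frac{2+s}{q}\right) 2 = \left(\frac{2}{q}\right)\left(\frac{2+t}{q}\right) 2.$$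
   Context: $\mathbb{F}_q$ is the field with $q$ elements and $\mathbb{F}_q^\times$ its set of nonzero elements. For $a\in\mathbb{F}_q$, the Legendre symbol $\left(\frac{a}{q}\right)$ equals $1$, $-1$ or $0$ according as $a$ is a nonzero square in $\mathbb{F}_q$, a nonsquare in $\mathbb{F}_q$, or $0$; in the formulas it is regarded as an element of $\mathbb{F}_q$. "Nonsquare" means an element of $\mathbb{F}_q$ that is not a square in $\mathbb{F}_q$ (so $0$ is not a nonsquare). For a finite subset $T\subseteq\mathbb{F}_q$, $\prod T$ denotes the product of all elements of $T$. *)

theory Defs
  imports
    "HOL-Library.Cardinality"
    "HOL-Computational_Algebra.Nth_Powers"
    "HOL-Number_Theory.Number_Theory"
begin

text \<open>
  \<open>Legendre\<close> from \<open>HOL-Number_Theory\<close> only covers residues modulo an integer. As there, the value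
  is an integer; it is taken into the field by \<open>of_int\<close>. Note that \<open>0\<close> is a square for
  \<^term>\<open>is_square\<close>.
\<close>

definition field_legendre :: "'a :: finite_field \<Rightarrow> int" where
  "field_legendre a = (if a = 0 then 0 else if is_square a then 1 else -1)"

end

theory Submission
  imports Defs "HOL-Algebra.Algebraic_Closure_Type"
begin

text \<open>
  All four products are values of one polynomial. Let \<open>S\<close> be the set of those \<open>b\<close> for which both
  \<open>b\<close> and \<open>4 - b\<close> are nonsquares. If \<open>c + d = 4\<close>, the substitution \<open>a = c - b\<close> turns the product of
  the \<open>a\<close> with \<open>c - a\<close> and \<open>d + a\<close> nonsquare into the product of \<open>c - b\<close> over \<open>b \<in> S\<close>
  (\<open>prod_translate\<close>). Hence only \<open>P(c) = (\<Prod>b\<in>S. c - b)\<close> has to be evaluated, at \<open>c = s\<^sup>2\<close>.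

  This is possible because \<open>S\<close> can be parametrized in the algebraic closure. Let \<open>n\<close> be the even one
  of \<open>(q - 1) / 2\<close> and \<open>(q + 1) / 2\<close>, and let \<open>\<iota>\<^sup>2 = -1\<close>. Every solution of \<open>r\<^sup>2 + e\<^sup>2 = 4\<close> has the form
  \<open>r = v + 1/v\<close>, \<open>e = \<iota> (v - 1/v)\<close>. For a sign \<open>\<eta>\<close>, the Frobenius map multiplies both \<open>r\<close> and
  \<open>e\<close> by \<open>\<eta>\<close> exactly if \<open>v^(2n) = \<eta>\<close> (\<open>frobenius_circle_iff\<close>); the choice of \<open>n\<close> makes up for the
  effect of the Frobenius map on \<open>\<iota>\<close>. A nonzero element of the field is a nonsquare exactly if the
  Frobenius map negates its square roots. With \<open>\<eta> = -1\<close> and \<open>w = v\<^sup>2\<close> it follows that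
  \<open>S = {w + 1/w + 2 | w^n = -1}\<close> (\<open>J_image_minus_1_roots\<close>), where \<open>w\<close> and \<open>1/w\<close> give the same element.
  Collecting the factors of \<open>y^n + 1\<close> in these pairs yields \<open>P((v + 1/v)\<^sup>2) = v^n + 1/v^n\<close>
  (\<open>prod_dickson\<close>): the polynomial \<open>P(X\<^sup>2)\<close> is the Dickson polynomial of degree \<open>n\<close>.

  If \<open>s\<^sup>2 + t\<^sup>2 = 4\<close> with \<open>s\<close> and \<open>t\<close> in the field, let \<open>v\<close> be the parameter of \<open>(s, t)\<close> and \<open>u\<^sup>2 = v\<close>.
  Then \<open>(u + 1/u)\<^sup>2 = 2 + s\<close>, so \<open>v^n = u^(2n)\<close> is the Legendre symbol of \<open>2 + s\<close>
  (\<open>prod_on_circle\<close>). This covers the points \<open>(2, 0)\<close> and \<open>(0, 2)\<close>, which give the first two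
  products, and the fourth one. The third product is the value at \<open>s = 1\<close>, where \<open>v\<^sup>3 = -1\<close> and only
  \<open>n mod 6\<close> matters (\<open>prod_at_1\<close>). The two forms of the fourth product agree because of
  \<open>2 (2 + s) (2 + t) = (2 + s + t)\<^sup>2\<close>.
\<close>

hide_const (open) Divisibility.prime

section \<open>Roots of a binomial\<close>

text \<open>
  Over an algebraically closed field, \<open>X^n - c\<close> is a product of linear factors. A repeated
  root would also be a root of the derivative \<open>n X^(n-1)\<close>, hence zero, but \<open>0^n \<noteq> c\<close>. So the factors
  are distinct.
\<close>

lemma prod_diff_nth_roots:
  fixes c y :: "'a :: alg_closed_field"
  assumes n: "of_nat n \<noteq> (0 :: 'a)" and c: "c \<noteq> 0"
  shows "(\<Prod>w | w ^ n = c. y - w) = y ^ n - c" and "card {w. w ^ n = c} = n"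
proof -
  have "n > 0" using n by (cases n) auto
  define p where "p = monom 1 n - [:c:]"
  have deg: "degree p = n"
  proof -
    have "degree p \<le> n" unfolding p_def by (rule degree_diff_le) (auto simp: degree_monom_eq)
    moreover have "coeff p n = 1" using \<open>n > 0\<close> by (simp add: p_def coeff_pCons split: nat.splits)
    ultimately show ?thesis by (metis le_antisym le_degree zero_neq_one)
  qed
  have lc: "lead_coeff p = 1" unfolding deg using \<open>n > 0\<close> by (simp add: p_def coeff_pCons split: nat.splits)
  have poly_p: "poly p x = x ^ n - c" for x by (simp add: p_def poly_monom)
  have "p \<noteq> 0" using lc by auto
  then obtain A where A: "size A = n" "p = (\<Prod>x\<in>#A. [:-x, 1:])"
    using alg_closed_imp_factorization[of p] lc deg by auto
  have set_A: "set_mset A = {w. w ^ n = c}"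
  proof -
    have "x \<in># A \<longleftrightarrow> poly p x = 0" for x
      unfolding A(2) poly_prod_mset by (auto simp: prod_mset_zero_iff)
    thus ?thesis by (auto simp: poly_p)
  qed
  have "count A x \<le> 1" for x
  proof (rule ccontr)
    assume "\<not> count A x \<le> 1"
    hence "{#x, x#} \<subseteq># A"
      by (auto simp: subseteq_mset_def)
    then obtain B where "A = {#x, x#} + B" by (metis subset_mset.add_diff_inverse)
    hence "p = [:-x, 1:] * ([:-x, 1:] * (\<Prod>x\<in>#B. [:-x, 1:]))" using A(2) by simp
    hence "poly (pderiv p) x = 0" "poly p x = 0"
      by (simp_all only: pderiv_mult poly_add poly_mult) simp_all
    moreover have "poly (pderiv p) x = of_nat n * x ^ (n - 1)"
      by (simp add: p_def pderiv_diff pderiv_monom poly_monom pderiv_pCons)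
    ultimately show False using n c poly_p[of x] \<open>n > 0\<close> by (auto simp: power_0_left)
  qed
  hence A_eq: "A = mset_set {w. w ^ n = c}"
    by (intro multiset_eqI) (metis count_mset_set(1) count_mset_set(3) count_greater_eq_one_iff
        le_antisym not_in_iff set_A finite_set_mset)
  show "card {w. w ^ n = c} = n" using A(1) A_eq by simp
  have "y ^ n - c = poly p y" by (simp add: poly_p)
  also have "\<dots> = (\<Prod>x\<in>#A. y - x)"
    unfolding A(2) poly_prod_mset by (simp add: multiset.map_comp o_def)
  also have "\<dots> = (\<Prod>w | w ^ n = c. y - w)"
    unfolding A_eq by (simp add: prod_unfold_prod_mset)
  finally show "(\<Prod>w | w ^ n = c. y - w) = y ^ n - c" ..
qed

section \<open>Squares and the Frobenius map\<close>

text \<open>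
  Translation by \<open>1\<close> permutes the field, so it does not change the sum of all elements, but it
  adds \<open>1\<close> to it once for each element.
\<close>

lemma of_nat_CARD_eq_0: "of_nat CARD('a) = (0 :: 'a :: finite_field)"
proof -
  have "(\<Sum>x::'a\<in>UNIV. x) = (\<Sum>x\<in>UNIV. x + 1)"
    by (rule sum.reindex_bij_witness[of _ "\<lambda>x. x + 1" "\<lambda>x. x - 1"]) auto
  thus ?thesis by (simp add: sum.distrib)
qed

locale odd_finite_field =
  fixes q :: nat and field_type :: "'a :: finite_field itself"
  assumes q_card: "q = CARD('a)" and primepow_q: "primepow q" and odd_q: "odd q"
begin

lemma power_of_CHAR:
  obtains k where "q = CHAR('a) ^ k"
proof -
  obtain p k where pk: "prime p" "q = p ^ k"
    using primepow_q by (auto simp: primepow_def)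
  have "prime CHAR('a)" by (rule prime_CHAR_semidom) (rule CHAR_pos)
  moreover have "CHAR('a) dvd p ^ k"
    using of_nat_CARD_eq_0[where 'a = 'a] pk q_card by (simp add: of_nat_eq_0_iff_char_dvd)
  ultimately have "CHAR('a) = p"
    using pk(1) by (metis prime_dvd_power primes_dvd_imp_eq)
  thus ?thesis using that pk by blast
qed

lemma q_ge_3: "q \<ge> 3"
  using primepow_gt_Suc_0[OF primepow_q] odd_q by (cases "q = 2") auto

lemma of_nat_q: "of_nat q = (0 :: 'a alg_closure)"
  using of_nat_CARD_eq_0[where 'a = 'a] q_card by (metis to_ac_0 to_ac_of_nat)

lemma two_neq_0: "(2 :: 'a) \<noteq> 0"
proof
  assume "(2 :: 'a) = 0"
  moreover obtain k where "q = 2 * k + 1" using odd_q by (elim oddE)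
  ultimately show False using of_nat_CARD_eq_0[where 'a = 'a] by (simp flip: q_card)
qed

lemma four_neq_0: "(4 :: 'a) \<noteq> 0"
  using two_neq_0 by (metis mult_eq_0_iff numeral_times_numeral semiring_norm(12) semiring_norm(13))

lemma closure_two_neq_0: "(2 :: 'a alg_closure) \<noteq> 0"
  and closure_four_neq_0: "(4 :: 'a alg_closure) \<noteq> 0"
  using two_neq_0 four_neq_0 to_ac_eq_0_iff[of "2 :: 'a"] to_ac_eq_0_iff[of "4 :: 'a"]
  by (simp_all del: to_ac_eq_0_iff)

lemma frobenius_add: "(x + y) ^ q = x ^ q + y ^ q" for x y :: "'a alg_closure"
proof -
  obtain k where "q = CHAR('a) ^ k" by (rule power_of_CHAR)
  moreover have "prime CHAR('a)" by (rule prime_CHAR_semidom) (rule CHAR_pos)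
  ultimately show ?thesis by (intro freshmans_dream'[of _ k]) auto
qed

lemma frobenius_diff: "(x - y) ^ q = x ^ q - y ^ q" for x y :: "'a alg_closure"
  using frobenius_add[of x "- y"] odd_q by simp

lemma frobenius_to_ac: "to_ac (x :: 'a) ^ q = to_ac x"
  using finite_field_power_card_eq_same[of x] q_card by (metis to_ac_power)

text \<open>
  The elements of the field already supply \<open>q\<close> roots of \<open>X^q - X\<close>, as many as its degree permits.
  This is how membership in the field is recognized inside the closure.
\<close>

lemma frobenius_fixed_iff: "x ^ q = x \<longleftrightarrow> x \<in> range to_ac" for x :: "'a alg_closure"
proof -
  define p :: "'a alg_closure poly" where "p = monom 1 q - monom 1 1"
  have poly_p: "poly p x = x ^ q - x" for x by (simp add: p_def poly_monom)
  have "coeff p q = 1" using q_ge_3 by (simp add: p_def)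
  hence "p \<noteq> 0" by auto
  have "degree p \<le> q"
    unfolding p_def using q_ge_3
    by (intro degree_diff_le) (auto intro: order.trans[OF degree_monom_le])
  have fin: "finite {x. poly p x = 0}" using \<open>p \<noteq> 0\<close> by (rule poly_roots_finite)
  have "range to_ac = {x. poly p x = 0}"
  proof (rule card_seteq[OF fin])
    show "range to_ac \<subseteq> {x. poly p x = 0}" by (auto simp: poly_p frobenius_to_ac)
    have "card {x. poly p x = 0} \<le> q"
      using card_poly_roots_bound[OF \<open>p \<noteq> 0\<close>] \<open>degree p \<le> q\<close> by linarith
    thus "card {x. poly p x = 0} \<le> card (range (to_ac :: 'a \<Rightarrow> _))"
      using inj_to_ac[where 'a = 'a] q_card by (simp add: card_image)
  qed
  thus ?thesis by (auto simp: poly_p)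
qed

lemma is_square_iff_frobenius_sqrt:
  assumes r: "r\<^sup>2 = to_ac (c :: 'a)"
  shows "is_square c \<longleftrightarrow> r ^ q = r"
proof
  assume "is_square c"
  then obtain y where "c = y\<^sup>2" by (auto simp: is_nth_power_def)
  hence "r = to_ac y \<or> r = - to_ac y" using r by (simp add: power2_eq_iff)
  thus "r ^ q = r" using odd_q by (auto simp: frobenius_to_ac)
next
  assume "r ^ q = r"
  then obtain y where "r = to_ac y" using frobenius_fixed_iff by auto
  hence "to_ac (y\<^sup>2) = to_ac c" using r by simp
  thus "is_square c" by (metis is_nth_powerI to_ac_eq_iff)
qed

text \<open>
  This is Euler's criterion, in the form in which it is used: \<open>(r^q)\<^sup>2 = c^q = c\<close>, so the
  Frobenius map can only fix or negate a square root of \<open>c\<close>, and it fixes it exactly if it lies in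
  the field.
\<close>

lemma frobenius_sqrt:
  assumes r: "r\<^sup>2 = to_ac (c :: 'a)"
  shows "r ^ q = of_int (field_legendre c) * r"
proof -
  have "(r ^ q)\<^sup>2 = r\<^sup>2"
    using frobenius_to_ac[of c] r by (metis mult.commute power_mult)
  hence "r ^ q = r \<or> r ^ q = - r" by (simp add: power2_eq_iff)
  moreover have "r = 0" if "c = 0" using r that by simp
  ultimately show ?thesis
    using is_square_iff_frobenius_sqrt[OF r] q_ge_3 by (auto simp: field_legendre_def power_0_left)
qed

lemma nonsquare_iff_frobenius_sqrt:
  assumes r: "r\<^sup>2 = to_ac (c :: 'a)"
  shows "\<not> is_square c \<longleftrightarrow> r \<noteq> 0 \<and> r ^ q = - r"
proof -
  have "r \<noteq> - r" if "r \<noteq> 0"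
    using that closure_two_neq_0 by (metis add.right_inverse mult_2 mult_eq_0_iff)
  thus ?thesis
    using frobenius_sqrt[OF r] is_square_iff_frobenius_sqrt[OF r] r
    by (auto simp: field_legendre_def)
qed

section \<open>The circle and its parametrization\<close>

text \<open>
  Of \<open>(q - 1) / 2\<close> and \<open>(q + 1) / 2\<close>, this is the even one. It is the degree of the Dickson polynomial
  that arises, and by \<open>2n = q \<mp> 1\<close> the power \<open>v^(2n)\<close> compares \<open>v^q\<close> with \<open>v\<close> or \<open>1/v\<close>.
\<close>

definition n :: nat where
  "n = (if q mod 4 = 1 then (q - 1) div 2 else (q + 1) div 2)"

lemma q_cases:
  obtains "q mod 4 = 1" "q = 2 * n + 1" | "q mod 4 = 3" "2 * n = q + 1"
proof -
  have "q mod 4 = 1 \<or> q mod 4 = 3" using odd_q by presburger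
  moreover have "q = 2 * n + 1" if "q mod 4 = 1"
    using that odd_q by (auto simp: n_def elim!: oddE)
  moreover have "2 * n = q + 1" if "q mod 4 = 3"
    using that odd_q by (auto simp: n_def elim!: oddE)
  ultimately show ?thesis using that by blast
qed

lemma even_n: "even n"
  by (rule q_cases) presburger+

lemma of_nat_n: "of_nat n \<noteq> (0 :: 'a alg_closure)"
proof
  assume *: "of_nat n = (0 :: 'a alg_closure)"
  show False
  proof (cases rule: q_cases)
    case 1
    have "of_nat q = (of_nat (2 * n + 1) :: 'a alg_closure)" using 1 by simp
    thus False using * of_nat_q by simp
  next
    case 2
    have "of_nat (2 * n) = (of_nat (q + 1) :: 'a alg_closure)" using 2 by simp
    thus False using * of_nat_q by simp
  qed
qed

definition \<iota> :: "'a alg_closure" where "\<iota> = (SOME x. x\<^sup>2 = -1)"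

lemma i_squared: "\<iota>\<^sup>2 = -1"
  unfolding \<iota>_def by (rule someI_ex) (use nth_root_exists[of 2] in auto)

lemma i_neq_0: "\<iota> \<noteq> 0"
  using i_squared by auto

lemma frobenius_i: "\<iota> ^ q = (if q mod 4 = 1 then \<iota> else - \<iota>)"
proof -
  have even: "\<iota> ^ (2 * n) = 1" using even_n by (simp add: power_mult i_squared)
  show ?thesis
  proof (cases rule: q_cases)
    case 1
    have "\<iota> ^ q = \<iota>" using even by (subst 1(2)) simp
    thus ?thesis using 1 by simp
  next
    case 2
    have "\<iota> ^ q * \<iota> = (- \<iota>) * \<iota>" using even 2 by (simp add: i_squared mult.commute flip: power2_eq_square)
    hence "\<iota> ^ q = - \<iota>" using i_neq_0 mult_right_cancel by blast
    thus ?thesis using 2 by simp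
  qed
qed

text \<open>
  Write \<open>F = v^q\<close>. If \<open>q mod 4 = 1\<close>, then \<open>\<iota>\<close> is fixed by the Frobenius map and the right-hand side
  says \<open>F + 1/F = \<eta> (v + 1/v)\<close> and \<open>F - 1/F = \<eta> (v - 1/v)\<close>, that is \<open>F = \<eta> v\<close>. If \<open>q mod 4 = 3\<close>, then
  \<open>\<iota>\<close> is negated, the second equation changes sign, and the two amount to \<open>F = \<eta> / v\<close>. In both cases
  this is \<open>v^(2n) = \<eta>\<close>, by the definition of \<open>n\<close>. Thus a single power of \<open>v\<close> records how the
  Frobenius map acts on a point of the circle \<open>r\<^sup>2 + e\<^sup>2 = 4\<close>.
\<close>

lemma frobenius_circle_iff:
  fixes v \<eta> :: "'a alg_closure"
  assumes v: "v \<noteq> 0" and \<eta>: "\<eta>\<^sup>2 = 1"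
  shows "v ^ (2 * n) = \<eta> \<longleftrightarrow> (v + 1 / v) ^ q = \<eta> * (v + 1 / v) \<and>
    (\<iota> * (v - 1 / v)) ^ q = \<eta> * (\<iota> * (v - 1 / v))"
proof -
  define F where "F = v ^ q"
  have F: "F \<noteq> 0" using v by (simp add: F_def)
  have \<eta>0: "\<eta> \<noteq> 0" using \<eta> by auto
  hence \<eta>i: "1 / \<eta> = \<eta>" using \<eta> by (simp add: divide_eq_eq power2_eq_square)
  have r: "(v + 1 / v) ^ q = F + 1 / F"
    by (simp add: frobenius_add F_def power_divide)
  have e: "(v - 1 / v) ^ q = F - 1 / F"
    by (simp add: frobenius_diff F_def power_divide)
  show ?thesis
  proof (cases rule: q_cases)
    case 1
    have "v ^ (2 * n) = \<eta> \<longleftrightarrow> F = \<eta> * v"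
      unfolding F_def by (subst 1(2)) (use v in simp)
    also have "\<dots> \<longleftrightarrow> F + 1 / F = \<eta> * (v + 1 / v) \<and> F - 1 / F = \<eta> * (v - 1 / v)"
    proof (rule iffI)
      assume "F + 1 / F = \<eta> * (v + 1 / v) \<and> F - 1 / F = \<eta> * (v - 1 / v)"
      hence *: "F + 1 / F = \<eta> * (v + 1 / v)" "F - 1 / F = \<eta> * (v - 1 / v)"
        by simp_all
      have "2 * F = (F + 1 / F) + (F - 1 / F)" by simp
      also have "\<dots> = 2 * (\<eta> * v)" unfolding * by (simp add: algebra_simps)
      finally show "F = \<eta> * v" using closure_two_neq_0 by simp
    next
      assume "F = \<eta> * v"
      moreover have "1 / (\<eta> * v) = \<eta> * (1 / v)" using \<eta>i by (metis mult.right_neutral times_divide_times_eq)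
      ultimately show "F + 1 / F = \<eta> * (v + 1 / v) \<and> F - 1 / F = \<eta> * (v - 1 / v)"
        by (simp_all add: algebra_simps)
    qed
    finally show ?thesis
      using 1 i_neq_0 by (simp add: r e power_mult_distrib frobenius_i)
  next
    case 2
    have "v ^ (2 * n) = F * v" unfolding 2 by (simp add: F_def)
    hence "v ^ (2 * n) = \<eta> \<longleftrightarrow> F = \<eta> * (1 / v)" using v by (simp add: field_simps)
    also have "\<dots> \<longleftrightarrow> F + 1 / F = \<eta> * (v + 1 / v) \<and> - (F - 1 / F) = \<eta> * (v - 1 / v)"
    proof (rule iffI)
      assume "F + 1 / F = \<eta> * (v + 1 / v) \<and> - (F - 1 / F) = \<eta> * (v - 1 / v)"
      hence *: "F + 1 / F = \<eta> * (v + 1 / v)" "- (F - 1 / F) = \<eta> * (v - 1 / v)"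
        by simp_all
      have "2 * F = (F + 1 / F) - (- (F - 1 / F))" by simp
      also have "\<dots> = 2 * (\<eta> * (1 / v))" unfolding * by (simp add: algebra_simps)
      finally show "F = \<eta> * (1 / v)" using closure_two_neq_0 mult_left_cancel by blast
    next
      assume "F = \<eta> * (1 / v)"
      moreover have "1 / (\<eta> * (1 / v)) = \<eta> * v" using \<eta> \<eta>0 v by (simp add: field_simps power2_eq_square)
      ultimately show "F + 1 / F = \<eta> * (v + 1 / v) \<and> - (F - 1 / F) = \<eta> * (v - 1 / v)"
        by (simp_all add: algebra_simps)
    qed
    also have "- (F - 1 / F) = \<eta> * (v - 1 / v) \<longleftrightarrow>
        \<iota> * (- (F - 1 / F)) = \<iota> * (\<eta> * (v - 1 / v))"
      using i_neq_0 mult_left_cancel by blast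
    also have "\<iota> * (- (F - 1 / F)) = (\<iota> * (v - 1 / v)) ^ q"
      unfolding power_mult_distrib e frobenius_i using 2 by (simp add: right_diff_distrib)
    finally show ?thesis
      by (simp only: r mult.left_commute[of \<iota>])
  qed
qed

text \<open>
  The circle factors as \<open>(s - \<iota> t) (s + \<iota> t) = 4\<close>, so half of the first factor serves as \<open>v\<close>, with half
  of the second as its inverse.
\<close>

lemma exists_circle_param:
  fixes s t :: "'a alg_closure"
  assumes "s\<^sup>2 + t\<^sup>2 = 4"
  obtains v where "v \<noteq> 0" "v + 1 / v = s" "\<iota> * (v - 1 / v) = t"
proof -
  define v where "v = (s - \<iota> * t) / 2"
  have prod: "v * ((s + \<iota> * t) / 2) = 1"
  proof -
    have "(s - \<iota> * t) * (s + \<iota> * t) = s\<^sup>2 - \<iota>\<^sup>2 * t\<^sup>2" by (simp add: algebra_simps power2_eq_square)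
    also have "\<dots> = 2 * 2" using assms by (simp add: i_squared)
    finally show ?thesis using closure_four_neq_0 by (simp add: v_def)
  qed
  hence v0: "v \<noteq> 0" by auto
  hence inv: "1 / v = (s + \<iota> * t) / 2" using prod by (simp add: field_simps)
  have "v + 1 / v = s" unfolding inv using closure_two_neq_0 by (simp add: v_def field_simps)
  moreover have "\<iota> * (v - 1 / v) = - (\<iota>\<^sup>2) * t"
    unfolding inv using closure_two_neq_0 by (simp add: v_def field_simps power2_eq_square)
  ultimately show ?thesis using v0 that i_squared by simp
qed

lemma circle_identity:
  assumes "v \<noteq> 0"
  shows "(v + 1 / v)\<^sup>2 + (\<iota> * (v - 1 / v))\<^sup>2 = 4"
proof -
  have difference: "(v + a)\<^sup>2 - (v - a)\<^sup>2 = 4 * (v * a)" for a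
    by (simp add: algebra_simps power2_eq_square)
  have "(v + 1 / v)\<^sup>2 + (\<iota> * (v - 1 / v))\<^sup>2 = (v + 1 / v)\<^sup>2 - (v - 1 / v)\<^sup>2"
    unfolding power_mult_distrib i_squared by simp
  thus ?thesis using assms by (simp only: difference) simp
qed

section \<open>The product as a Dickson polynomial\<close>

definition nonsquare_pairs :: "'a set" where "nonsquare_pairs = {b. \<not> is_square b \<and> \<not> is_square (4 - b)}"

definition minus_1_roots :: "'a alg_closure set" where "minus_1_roots = {w. w ^ n = -1}"

text \<open>
  This is the Joukowski map, shifted so that \<open>J (v\<^sup>2)\<close> is the square of \<open>v + 1/v\<close>.
\<close>

definition J :: "'a alg_closure \<Rightarrow> 'a alg_closure" where "J w = w + 1 / w + 2"

lemma J_square: "v \<noteq> 0 \<Longrightarrow> J (v\<^sup>2) = (v + 1 / v)\<^sup>2"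
  by (simp add: J_def power2_sum power_divide)

lemma n_pos: "n > 0"
  using of_nat_n by (cases n) auto

lemma minus_1_roots_nonzero: "w \<in> minus_1_roots \<Longrightarrow> w \<noteq> 0"
  using n_pos by (auto simp: minus_1_roots_def power_0_left)

lemma minus_1_neq_1: "(-1 :: 'a alg_closure) \<noteq> 1"
  using closure_two_neq_0 by (metis add.right_inverse one_add_one)

text \<open>
  Since \<open>n\<close> is even, \<open>w\<^sup>2 = 1\<close> would give \<open>w^n = 1\<close>. This makes \<open>w\<close> different from \<open>1/w\<close>, and it keeps
  \<open>J w\<close> away from \<open>0\<close> and \<open>4\<close>.
\<close>

lemma minus_1_roots_square_neq_1: assumes "w \<in> minus_1_roots" shows "w\<^sup>2 \<noteq> 1"
proof
  assume "w\<^sup>2 = 1"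
  moreover obtain k where "n = 2 * k" using even_n by (elim evenE)
  ultimately have "w ^ n = 1" by (simp add: power_mult)
  thus False using assms minus_1_neq_1 by (simp add: minus_1_roots_def)
qed

text \<open>
  For \<open>w = v\<^sup>2\<close>, the elements \<open>r = v + 1/v\<close> and \<open>e = \<iota> (v - 1/v)\<close> are square roots of \<open>J w\<close> and
  \<open>4 - J w\<close>. The latter two are nonsquares of the field exactly if the Frobenius map negates both
  (nonzero) roots, which means \<open>v^(2n) = -1\<close>.
\<close>

lemma J_image_minus_1_roots: "J ` minus_1_roots = to_ac ` nonsquare_pairs"
proof (intro equalityI subsetI)
  fix x assume "x \<in> J ` minus_1_roots"
  then obtain w where w: "w \<in> minus_1_roots" "x = J w" by auto
  obtain v where v: "v\<^sup>2 = w" using nth_root_exists[of 2 w] by auto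
  have v0: "v \<noteq> 0" using minus_1_roots_nonzero[OF w(1)] v by auto
  define r e where "r = v + 1 / v" and "e = \<iota> * (v - 1 / v)"
  have "v ^ (2 * n) = -1" using w v by (simp add: minus_1_roots_def power_mult)
  hence frob: "r ^ q = - r" "e ^ q = - e"
    using frobenius_circle_iff[OF v0, of "-1"] by (simp_all add: r_def e_def)
  have "x ^ q = x" using frob(1) w v v0 J_square[of v] odd_q
    by (metis (no_types, lifting) mult.commute power2_minus power_mult r_def)
  then obtain b where b: "x = to_ac b" using frobenius_fixed_iff by auto
  have r2: "r\<^sup>2 = to_ac b" using b w v v0 J_square[of v] by (simp add: r_def)
  have e2: "e\<^sup>2 = to_ac (4 - b)"
    using circle_identity[OF v0] r2 unfolding r_def[symmetric] e_def[symmetric]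
    by (simp add: eq_diff_eq add.commute)
  have neq: "w \<noteq> 1" "w \<noteq> -1" using minus_1_roots_square_neq_1[OF w(1)] by auto
  have "r \<noteq> 0" using neq v v0
    by (auto simp: r_def field_simps power2_eq_square add_eq_0_iff)
  moreover have "e \<noteq> 0" using neq v v0 i_neq_0
    by (auto simp: e_def field_simps power2_eq_square)
  ultimately have "b \<in> nonsquare_pairs"
    using frob nonsquare_iff_frobenius_sqrt r2 e2 by (auto simp: nonsquare_pairs_def)
  thus "x \<in> to_ac ` nonsquare_pairs" using b by blast
next
  fix x assume "x \<in> to_ac ` nonsquare_pairs"
  then obtain b where b: "x = to_ac b" "\<not> is_square b" "\<not> is_square (4 - b)" by (auto simp: nonsquare_pairs_def)
  obtain r where r: "r\<^sup>2 = to_ac b" using nth_root_exists[of 2 "to_ac b"] by auto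
  obtain e where e: "e\<^sup>2 = to_ac (4 - b)" using nth_root_exists[of 2 "to_ac (4 - b)"] by auto
  have "r\<^sup>2 + e\<^sup>2 = 4" using r e by simp
  then obtain v where v: "v \<noteq> 0" "v + 1 / v = r" "\<iota> * (v - 1 / v) = e" by (rule exists_circle_param)
  have "v ^ (2 * n) = -1"
    using b r e nonsquare_iff_frobenius_sqrt frobenius_circle_iff[OF v(1), of "-1"] v by auto
  hence "v\<^sup>2 \<in> minus_1_roots" by (simp add: minus_1_roots_def power_mult)
  moreover have "x = J (v\<^sup>2)" using v r b J_square by simp
  ultimately show "x \<in> J ` minus_1_roots" by blast
qed

lemma J_eq_iff:
  assumes "w \<noteq> 0" "w' \<noteq> 0"
  shows "J w = J w' \<longleftrightarrow> w = w' \<or> w = 1 / w'"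
proof -
  have "(J w - J w') * (w * w') =
      (w - w') * (w * w') + (w * (1 / w)) * w' - w * (w' * (1 / w'))"
    by (simp only: J_def) (simp only: algebra_simps)
  also have "\<dots> = (w - w') * (w * w' - 1)"
    using assms by (simp add: algebra_simps)
  finally have "J w = J w' \<longleftrightarrow> w = w' \<or> w * w' = 1"
    using assms by (metis eq_iff_diff_eq_0 mult_eq_0_iff)
  thus ?thesis using assms by (simp add: eq_divide_eq)
qed

text \<open>
  Evaluate \<open>y^n + 1 = (\<Prod>w. y - w)\<close> at \<open>y = v\<^sup>2\<close> and pair the factors of \<open>w\<close> and \<open>1/w\<close>: each pair
  contributes \<open>(y - w) (y - 1/w) = y (J y - J w)\<close>. There are \<open>n / 2\<close> pairs, so dividing by \<open>y^(n/2) = v^n\<close>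
  gives the claim.
\<close>

lemma prod_dickson:
  assumes v: "v \<noteq> 0"
  shows "(\<Prod>b\<in>nonsquare_pairs. (v + 1 / v)\<^sup>2 - to_ac b) = v ^ n + 1 / v ^ n"
proof -
  have roots: "(\<Prod>w\<in>minus_1_roots. v\<^sup>2 - w) = (v\<^sup>2) ^ n + 1" "card minus_1_roots = n"
    using prod_diff_nth_roots[OF of_nat_n, of "-1"] by (simp_all add: minus_1_roots_def)
  have fin: "finite minus_1_roots" using roots(2) n_pos by (metis card.infinite less_numeral_extra(3))
  have fibre: "card {w \<in> minus_1_roots. J w = x} = 2 \<and>
      (\<Prod>w | w \<in> minus_1_roots \<and> J w = x. v\<^sup>2 - w) = v\<^sup>2 * ((v + 1 / v)\<^sup>2 - x)"
    if "x \<in> J ` minus_1_roots" for x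
  proof -
    from that obtain u where u: "u \<in> minus_1_roots" "x = J u" by auto
    have u0: "u \<noteq> 0" using minus_1_roots_nonzero u by auto
    have "1 / u \<in> minus_1_roots" using u by (simp add: minus_1_roots_def power_divide)
    hence eq: "{w \<in> minus_1_roots. J w = x} = {u, 1 / u}"
      using u u0 J_eq_iff minus_1_roots_nonzero by auto
    have neq: "u \<noteq> 1 / u" using minus_1_roots_square_neq_1[OF u(1)] u0 by (auto simp: field_simps power2_eq_square)
    have "(v\<^sup>2 - u) * (v\<^sup>2 - 1 / u) = v\<^sup>2 * ((v + 1 / v)\<^sup>2 - J u)"
    proof -
      define a b where "a = 1 / v" and "b = 1 / u"
      have "v * a = 1" "u * b = 1" using u0 v by (simp_all add: a_def b_def)
      moreover have "(v\<^sup>2 - u) * (v\<^sup>2 - b) = v\<^sup>2 * v\<^sup>2 - v\<^sup>2 * (u + b) + u * b"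
        by (simp add: algebra_simps)
      moreover have "v\<^sup>2 * ((v + a)\<^sup>2 - (u + b + 2)) =
          v\<^sup>2 * v\<^sup>2 + 2 * v\<^sup>2 * (v * a) + (v * a)\<^sup>2 - v\<^sup>2 * (u + b) - 2 * v\<^sup>2"
        by (simp add: algebra_simps power2_eq_square)
      ultimately have "(v\<^sup>2 - u) * (v\<^sup>2 - b) = v\<^sup>2 * ((v + a)\<^sup>2 - (u + b + 2))" by simp
      thus ?thesis by (simp add: J_def a_def b_def)
    qed
    thus ?thesis using eq neq u by simp
  qed
  have "n = (\<Sum>w\<in>minus_1_roots. 1)" using roots by simp
  also have "\<dots> = (\<Sum>x\<in>J ` minus_1_roots. \<Sum>w | w \<in> minus_1_roots \<and> J w = x. 1)"
    by (rule sum.image_gen[OF fin])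
  also have "\<dots> = 2 * card (J ` minus_1_roots)" using fibre by simp
  finally have card: "n = 2 * card (J ` minus_1_roots)" .
  have "(v\<^sup>2) ^ n + 1 = (\<Prod>x\<in>J ` minus_1_roots. \<Prod>w | w \<in> minus_1_roots \<and> J w = x. v\<^sup>2 - w)"
    unfolding roots(1)[symmetric] by (rule prod.image_gen[OF fin])
  also have "\<dots> = (\<Prod>x\<in>J ` minus_1_roots. v\<^sup>2 * ((v + 1 / v)\<^sup>2 - x))" using fibre by simp
  also have "\<dots> = v ^ n * (\<Prod>x\<in>J ` minus_1_roots. (v + 1 / v)\<^sup>2 - x)"
    using card by (simp add: prod.distrib flip: power_mult)
  also have "(\<Prod>x\<in>J ` minus_1_roots. (v + 1 / v)\<^sup>2 - x) = (\<Prod>b\<in>nonsquare_pairs. (v + 1 / v)\<^sup>2 - to_ac b)"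
    unfolding J_image_minus_1_roots by (subst prod.reindex) (auto intro: inj_on_subset[OF inj_to_ac])
  finally have "v ^ n * (\<Prod>b\<in>nonsquare_pairs. (v + 1 / v)\<^sup>2 - to_ac b) = v ^ n * v ^ n + 1"
    by (simp add: power2_eq_square power_mult_distrib)
  moreover have "v ^ n \<noteq> 0" using v by simp
  ultimately show ?thesis by (metis add_divide_distrib nonzero_mult_div_cancel_left)
qed

section \<open>Evaluation\<close>

lemma prod_translate:
  fixes c d :: 'a
  assumes "c + d = 4"
  shows "\<Prod>{a. \<not> is_square (c - a) \<and> \<not> is_square (d + a)} = (\<Prod>b\<in>nonsquare_pairs. c - b)"
proof -
  have "4 - b = d + (c - b)" for b
    by (simp add: algebra_simps flip: assms)
  note eq = this
  show ?thesis
    by (intro prod.reindex_bij_witness[of _ "\<lambda>b. c - b" "\<lambda>a. c - a"]) (simp_all add: nonsquare_pairs_def eq)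
qed

text \<open>
  The value is \<open>v^n + 1/v^n\<close>, where \<open>v\<close> is the parameter of \<open>(s, t)\<close>. To find \<open>v^n\<close>, pass to a square root
  \<open>u\<close> of \<open>v\<close>, the parameter of a point \<open>(r, e)\<close> with \<open>r\<^sup>2 = 2 + s\<close> and \<open>r e = t\<close>. The Frobenius map
  multiplies \<open>r\<close> by the Legendre symbol of \<open>2 + s\<close> and fixes \<open>t\<close>, so it multiplies \<open>e\<close> by the same
  sign, and this sign is \<open>u^(2n) = v^n\<close>. For \<open>s = -2\<close> the symbol vanishes but the product does not.
\<close>

lemma prod_on_circle:
  fixes s t :: 'a
  assumes st: "s\<^sup>2 + t\<^sup>2 = 4" and s: "s \<noteq> -2"
  shows "\<Prod>{a. \<not> is_square (s\<^sup>2 - a) \<and> \<not> is_square (t\<^sup>2 + a)} = of_int (field_legendre (2 + s)) * 2"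
proof -
  define \<chi> :: "'a alg_closure" where "\<chi> = of_int (field_legendre (2 + s))"
  have "2 + s \<noteq> 0" using s by (metis add_eq_0_iff)
  hence \<chi>: "\<chi> = 1 \<or> \<chi> = -1" by (auto simp: \<chi>_def field_legendre_def)
  have "to_ac s ^ 2 + to_ac t ^ 2 = 4" using st by (metis to_ac_add to_ac_numeral to_ac_power)
  then obtain v where v: "v \<noteq> 0" "v + 1 / v = to_ac s" "\<iota> * (v - 1 / v) = to_ac t"
    by (rule exists_circle_param)
  obtain u where u: "u\<^sup>2 = v" using nth_root_exists[of 2 v] by auto
  have u0: "u \<noteq> 0" using u v by auto
  define r e where "r = u + 1 / u" and "e = \<iota> * (u - 1 / u)"
  have r2: "r\<^sup>2 = to_ac (2 + s)"
    using J_square[OF u0] v(2) by (simp add: r_def u J_def algebra_simps)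
  have r0: "r \<noteq> 0" using r2 \<open>2 + s \<noteq> 0\<close> by (metis to_ac_eq_0_iff zero_power2)
  have frob_r: "r ^ q = \<chi> * r" using frobenius_sqrt[OF r2] by (simp add: \<chi>_def)
  have "r * e = \<iota> * (u\<^sup>2 - (1 / u)\<^sup>2)"
    by (simp only: r_def e_def power2_eq_square) (simp only: algebra_simps)
  hence re: "r * e = to_ac t" using v(3) u by (simp add: power_divide)
  have "\<chi> * r * e ^ q = r * e"
    using frobenius_to_ac[of t] re frob_r by (metis power_mult_distrib)
  hence frob_e: "e ^ q = \<chi> * e" using \<chi> r0 by (auto simp: minus_equation_iff)
  have "u ^ (2 * n) = \<chi>"
    using frobenius_circle_iff[OF u0, of \<chi>] \<chi> frob_r frob_e by (auto simp: r_def e_def)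
  hence "v ^ n = \<chi>" using u by (simp add: power_mult)
  hence "v ^ n + 1 / v ^ n = \<chi> * 2" using \<chi> by auto
  hence "(\<Prod>b\<in>nonsquare_pairs. to_ac s ^ 2 - to_ac b) = \<chi> * 2" using prod_dickson[OF v(1)] v(2) by simp
  hence "to_ac (\<Prod>b\<in>nonsquare_pairs. s\<^sup>2 - b) = to_ac (of_int (field_legendre (2 + s)) * 2)"
    by (simp add: to_ac_prod \<chi>_def)
  thus ?thesis unfolding prod_translate[OF st] by (simp only: to_ac_eq_iff)
qed

text \<open>
  Here \<open>v + 1/v = 1\<close>, so \<open>v\<^sup>3 = -1\<close>, and the even powers of \<open>v\<close> are \<open>1\<close>, \<open>v\<^sup>2\<close> and \<open>v^4\<close>, with
  \<open>v\<^sup>2 + v^4 = v\<^sup>2 - v = -1\<close>. The value \<open>s = 1\<close> needs its own argument because \<open>4 - s\<^sup>2 = 3\<close> may fail to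
  be a square in the field.
\<close>

lemma prod_at_1:
  "\<Prod>{a :: 'a. \<not> is_square (1 - a) \<and> \<not> is_square (3 + a)} = (if 6 dvd n then 2 else -1)"
proof -
  obtain d :: "'a alg_closure" where "d\<^sup>2 = 3" using nth_root_exists[of 2 3] by auto
  hence "1\<^sup>2 + d\<^sup>2 = 4" by simp
  then obtain v where v: "v \<noteq> 0" "v + 1 / v = 1" "\<iota> * (v - 1 / v) = d" by (rule exists_circle_param)
  have "v * (v + 1 / v) = v * 1" by (simp only: v(2))
  hence v2: "v\<^sup>2 = v - 1" using v(1) by (simp add: distrib_left power2_eq_square eq_diff_eq)
  have "v ^ 3 = v * v\<^sup>2" by (simp add: power3_eq_cube power2_eq_square)
  also have "\<dots> = v * (v - 1)" by (simp only: v2)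
  also have "\<dots> = v\<^sup>2 - v" by (simp add: right_diff_distrib power2_eq_square)
  finally have v3: "v ^ 3 = -1" using v2 by simp
  have "v ^ 6 = (v ^ 3)\<^sup>2" by (simp flip: power_mult)
  hence v6: "v ^ 6 = 1" by (simp add: v3)
  have "v ^ n = v ^ (6 * (n div 6) + n mod 6)" by simp
  also have "\<dots> = v ^ (n mod 6)" by (simp only: power_add power_mult v6) simp
  finally have vn: "v ^ n = v ^ (n mod 6)" .
  have "n mod 6 = 0 \<or> n mod 6 = 2 \<or> n mod 6 = 4" using even_n by presburger
  moreover have "v ^ n + 1 / v ^ n = -1" if "n mod 6 = 2"
  proof -
    have "v\<^sup>2 * (- v) = 1" using v3 by (simp add: power2_eq_square power3_eq_cube mult.assoc)
    hence "1 / v\<^sup>2 = - v" using v(1) by (metis nonzero_eq_divide_eq mult.commute power_not_zero)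
    thus ?thesis using vn that v2 by simp
  qed
  moreover have "v ^ n + 1 / v ^ n = -1" if "n mod 6 = 4"
  proof -
    have "v ^ 4 = - v" using v3 by (simp add: eval_nat_numeral)
    moreover have "v\<^sup>2 * (- v) = 1" using v3 by (simp add: power2_eq_square power3_eq_cube mult.assoc)
    hence "1 / (- v) = v\<^sup>2" using v(1) by (metis nonzero_eq_divide_eq neg_equal_0_iff_equal)
    ultimately show ?thesis using vn that v2 by simp
  qed
  moreover have "v ^ n + 1 / v ^ n = 2" if "n mod 6 = 0" using vn that by simp
  ultimately have "v ^ n + 1 / v ^ n = (if 6 dvd n then 2 else -1)"
    by (auto simp: dvd_eq_mod_eq_0)
  hence "to_ac (\<Prod>b\<in>nonsquare_pairs. 1 - b) = to_ac (if 6 dvd n then 2 else -1)"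
    using prod_dickson[OF v(1)] v(2) by (simp add: to_ac_prod)
  thus ?thesis using prod_translate[of 1 3] by simp
qed

lemma six_dvd_n_iff: "6 dvd n \<longleftrightarrow> [int q = 1] (mod 12) \<or> [int q = -1] (mod 12)"
proof (cases rule: q_cases)
  case 1
  obtain k where k: "q = 4 * k + 1" using 1(1) by (metis div_mult_mod_eq mult.commute)
  hence n: "n = 2 * k" using 1 by simp
  have "6 dvd n \<longleftrightarrow> 3 dvd k" unfolding n by presburger
  moreover have "[int q = 1] (mod 12) \<longleftrightarrow> 3 dvd k"
    unfolding k cong_iff_dvd_diff by simp presburger
  moreover have "\<not> [int q = -1] (mod 12)"
    unfolding k cong_iff_dvd_diff by simp presburger
  ultimately show ?thesis by simp
next
  case 2
  obtain k where k: "q = 4 * k + 3" using 2(1) by (metis div_mult_mod_eq mult.commute)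
  hence n: "n = 2 * k + 2" using 2 by simp
  have "6 dvd n \<longleftrightarrow> 3 dvd k + 1" unfolding n by presburger
  moreover have "\<not> [int q = 1] (mod 12)"
    unfolding k cong_iff_dvd_diff by simp presburger
  moreover have "[int q = -1] (mod 12) \<longleftrightarrow> 3 dvd k + 1"
    unfolding k cong_iff_dvd_diff by simp presburger
  ultimately show ?thesis by simp
qed

lemma field_legendre_mult:
  fixes a b :: 'a
  shows "of_int (field_legendre (a * b)) = (of_int (field_legendre a) * of_int (field_legendre b) :: 'a)"
proof (cases "a * b = 0")
  case False
  obtain x where x: "x\<^sup>2 = to_ac a" using nth_root_exists[of 2 "to_ac a"] by auto
  obtain y where y: "y\<^sup>2 = to_ac b" using nth_root_exists[of 2 "to_ac b"] by auto
  have xy: "(x * y)\<^sup>2 = to_ac (a * b)" using x y by (simp add: power_mult_distrib)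
  hence "x * y \<noteq> 0" using False by auto
  moreover have "of_int (field_legendre (a * b)) * (x * y) =
      of_int (field_legendre a) * of_int (field_legendre b) * (x * y)"
  proof -
    have "of_int (field_legendre (a * b)) * (x * y) = x ^ q * y ^ q"
      by (simp only: frobenius_sqrt[OF xy, symmetric] power_mult_distrib)
    also have "\<dots> = (of_int (field_legendre a) * x) * (of_int (field_legendre b) * y)"
      by (simp only: frobenius_sqrt[OF x] frobenius_sqrt[OF y])
    finally show ?thesis by (simp only: mult_ac)
  qed
  ultimately have "to_ac (of_int (field_legendre (a * b))) =
      to_ac (of_int (field_legendre a) * of_int (field_legendre b) :: 'a)"
    by simp
  thus ?thesis by (simp only: to_ac_eq_iff)
qed (auto simp: field_legendre_def)

text \<open>
  The product of \<open>2 + s\<close>, \<open>2\<close> and \<open>2 + t\<close> is \<open>(2 + s + t)\<^sup>2\<close>, because \<open>s\<^sup>2 + t\<^sup>2 = 4\<close>.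
  The Legendre symbols of these three nonzero factors therefore multiply to \<open>1\<close>.
\<close>

lemma field_legendre_circle:
  fixes s t :: 'a
  assumes st: "s\<^sup>2 + t\<^sup>2 = 4" and s: "s \<noteq> -2" and t: "t \<noteq> -2"
  shows "(of_int (field_legendre (2 + s)) :: 'a) =
    of_int (field_legendre (2 :: 'a)) * of_int (field_legendre (2 + t))"
proof -
  have nz: "2 + s \<noteq> 0" "2 + t \<noteq> 0" using s t by (metis add_eq_0_iff)+
  have "(2 + s) * (2 * (2 + t)) = 4 + 4 + 4 * s + 4 * t + 2 * s * t" by (simp add: algebra_simps)
  also have "\<dots> = 4 + (s\<^sup>2 + t\<^sup>2) + 4 * s + 4 * t + 2 * s * t" by (simp only: st)
  also have "\<dots> = (2 + s + t)\<^sup>2" by (simp add: algebra_simps power2_eq_square)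
  finally have sq: "(2 + s) * (2 * (2 + t)) = (2 + s + t)\<^sup>2" .
  have "(2 + s) * (2 * (2 + t)) \<noteq> 0" using nz two_neq_0 by (simp only: mult_eq_0_iff) simp
  hence "field_legendre ((2 + s) * (2 * (2 + t))) = 1"
    unfolding field_legendre_def sq by simp
  hence "of_int (field_legendre (2 + s)) *
      (of_int (field_legendre (2 :: 'a)) * of_int (field_legendre (2 + t))) = (1 :: 'a)"
    by (metis field_legendre_mult of_int_1)
  thus ?thesis
    using nz by (auto simp: field_legendre_def minus_equation_iff split: if_splits)
qed

end

theorem theorem3p1:
  fixes q :: nat
  assumes q_card: "q = CARD('a :: finite_field)"
    and q_primepow: "primepow q"
    and q_odd: "odd q"
  shows "\<Prod>{a :: 'a. \<not> is_square a \<and> \<not> is_square (4 - a)} = 2 \<and>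
    \<Prod>{a :: 'a. \<not> is_square (- a) \<and> \<not> is_square (4 + a)} =
      of_int (field_legendre (2 :: 'a)) * 2 \<and>
    \<Prod>{a :: 'a. a \<noteq> 0 \<and> \<not> is_square (1 - a) \<and> \<not> is_square (a + 3)} =
      (if [int q = 1] (mod 12) \<or> [int q = -1] (mod 12) then 2 else -1) \<and>
    (\<forall>s t :: 'a. s \<noteq> 0 \<and> t \<noteq> 0 \<and> s\<^sup>2 + t\<^sup>2 = 4 \<longrightarrow>
      \<Prod>{a :: 'a. \<not> is_square (s\<^sup>2 - a) \<and> \<not> is_square (t\<^sup>2 + a)} =
        of_int (field_legendre (2 + s)) * 2 \<and>
      of_int (field_legendre (2 + s)) * 2 =
        (of_int (field_legendre (2 :: 'a)) * of_int (field_legendre (2 + t)) * 2 :: 'a))"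
proof -
  interpret odd_finite_field q "TYPE('a)"
    by standard (fact q_card q_primepow q_odd)+
  have "(2 :: 'a) \<noteq> -2" using four_neq_0 by (simp add: eq_neg_iff_add_eq_0)
  moreover have "is_square (4 :: 'a)" by (rule is_nth_powerI[of _ 2]) simp
  ultimately have 1: "\<Prod>{a :: 'a. \<not> is_square a \<and> \<not> is_square (4 - a)} = 2"
    using prod_on_circle[of 2 0] four_neq_0 by (simp add: field_legendre_def conj_commute)
  have 2: "\<Prod>{a :: 'a. \<not> is_square (- a) \<and> \<not> is_square (4 + a)} =
      of_int (field_legendre (2 :: 'a)) * 2"
    using prod_on_circle[of 0 2] two_neq_0 by simp
  \<comment> \<open>At \<open>a = 0\<close>, the element \<open>1 - a\<close> is a square.\<close>
  have "{a :: 'a. a \<noteq> 0 \<and> \<not> is_square (1 - a) \<and> \<not> is_square (a + 3)} =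
      {a. \<not> is_square (1 - a) \<and> \<not> is_square (3 + a)}"
    by (auto simp: add.commute)
  hence 3: "\<Prod>{a :: 'a. a \<noteq> 0 \<and> \<not> is_square (1 - a) \<and> \<not> is_square (a + 3)} =
      (if [int q = 1] (mod 12) \<or> [int q = -1] (mod 12) then 2 else -1)"
    by (simp only: prod_at_1 six_dvd_n_iff)
  have 4: "\<Prod>{a :: 'a. \<not> is_square (s\<^sup>2 - a) \<and> \<not> is_square (t\<^sup>2 + a)} =
        of_int (field_legendre (2 + s)) * 2 \<and>
      of_int (field_legendre (2 + s)) * 2 =
        (of_int (field_legendre (2 :: 'a)) * of_int (field_legendre (2 + t)) * 2 :: 'a)"
    if st: "s \<noteq> 0 \<and> t \<noteq> 0 \<and> s\<^sup>2 + t\<^sup>2 = 4" for s t :: 'a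
  proof -
    have circle: "s\<^sup>2 + t\<^sup>2 = 4" using st by blast
    moreover have s: "s \<noteq> -2" and "t \<noteq> -2" using st by auto
    ultimately have "(of_int (field_legendre (2 + s)) :: 'a) =
        of_int (field_legendre (2 :: 'a)) * of_int (field_legendre (2 + t))"
      by (rule field_legendre_circle)
    with prod_on_circle[OF circle s] show ?thesis by (simp only: simp_thms)
  qed
  show ?thesis using 1 2 3 4 by blast
qed

end
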